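(* Let $n\ge 1$ and $\lceil n/2\rceil \le k\le n$, and let $\mathcal{P}_{n,k}$ denote the set of $\mathcal{P}$-positions of the game PathNim $\mathrm{PN}(n,k)$. If $k<n$, then $$\mathcal{P}_{n,k}=\Big\{(a_1,\ldots,a_\ell,\underbrace{0,\ldots,0}_{k-1},b_1,\ldots,b_m)\ \Big|\ \ell+m=n-k+1,\ \sum_{i=1}^{\ell} a_i=\sum_{j=1}^m b_j,\ \min\{\ell,m\}\geq 1\Big\},$$ where $\ell,m$ are integers and the $a_i,b_j$ are non-negative integers. For $k=n$, $\mathcal{P}_{n,n}=\{(0,\ldots,0)\}$.
   Context: PathNim $\mathrm{PN}(n,k)$ is played on $n$ stacks of tokens arranged on a path with vertices $1,\ldots,n$. A position is a vector $(p_1,\ldots,p_n)$ of non-negative integers (stack heights). In each move, a player selects $k$ consecutive vertices $\{i,i+1,\ldots,i+k-1\}$ with $1\le i\le n-k+1$ and removes at least one token in total from the selected stacks (any number of tokens may be removed from each selected stack, including none, as long as at least one token is removed overall). Two players alternate, and the last player to move wins. An $\mathcal{N}$-position is one from which the player about to move can win with optimal play; a $\mathcal{P}$-position is one from which the player about to move loses against optimal play. *)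

theory Defs imports Complex_Main begin

text \<open>A position is the list of stack heights; vertex \<open>v\<close> of the path (numbered from 1) is
  list index \<open>v - 1\<close>, so the window \<open>{v, \<dots>, v + k - 1}\<close> becomes \<open>{i..<i + k}\<close> with
  \<open>i = v - 1\<close>, and \<open>1 \<le> v \<le> n - k + 1\<close> becomes \<open>i + k \<le> n\<close>.\<close>

definition positions :: "nat \<Rightarrow> nat list set" where
  "positions n = {p. length p = n}"

definition pn_move :: "nat \<Rightarrow> nat \<Rightarrow> nat list \<Rightarrow> nat list \<Rightarrow> bool" where
  "pn_move n k p q \<longleftrightarrow>
     p \<in> positions n \<and> q \<in> positions n \<and>
     (\<exists>i. i + k \<le> n \<and>
        (\<forall>j<n. j \<notin> {i..<i + k} \<longrightarrow> q ! j = p ! j) \<and>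
        (\<forall>j\<in>{i..<i + k}. q ! j \<le> p ! j) \<and>
        (\<Sum>j\<in>{i..<i + k}. p ! j - q ! j) \<ge> 1)"

text \<open>Outcomes under normal play for the impartial game with move relation \<open>mv\<close>.
  \<open>mover_wins mv p\<close>: the player about to move in \<open>p\<close> can force a win;
  \<open>mover_loses mv p\<close>: the opponent can. A player who cannot move has lost, which is the
  instance of the second rule in which the premise is vacuous.\<close>

inductive mover_wins :: "('a \<Rightarrow> 'a \<Rightarrow> bool) \<Rightarrow> 'a \<Rightarrow> bool"
  and mover_loses :: "('a \<Rightarrow> 'a \<Rightarrow> bool) \<Rightarrow> 'a \<Rightarrow> bool"
  for mv :: "'a \<Rightarrow> 'a \<Rightarrow> bool" where
  wins: "mv p q \<Longrightarrow> mover_loses mv q \<Longrightarrow> mover_wins mv p"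
| loses: "(\<And>q. mv p q \<Longrightarrow> mover_wins mv q) \<Longrightarrow> mover_loses mv p"

definition P_positions :: "nat \<Rightarrow> nat \<Rightarrow> nat list set" where
  "P_positions n k = {p \<in> positions n. mover_loses (pn_move n k) p}"

end

theory Submission imports Defs begin

text \<open>
  If \<open>k = n\<close>, then every nonzero position can be emptied at once. Let \<open>k < n\<close>.
  The claimed set is shown to be the kernel of the move graph: no move joins two of its members,
  and every other position has a move into it. Since moves decrease the total number of tokens,
  the kernel is exactly the set of \<open>\<P>\<close>-positions (\<open>mover_loses_iff_mem_kernel\<close>). Write \<open>k = z + 1\<close>,
  and call a position balanced at \<open>l\<close> if the stacks \<open>l, \<dots>, l + z - 1\<close> are empty, there are stacks
  on both sides of this block, and both sides contain equally many tokens.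

  \<^item> Independence (\<open>no_move_between_balanced\<close>): a window of \<open>z + 1\<close> stacks cannot reach both sides of
    a block of \<open>z\<close> stacks, so a move from a balanced position lowers the token sum of just one side.
    The block could now be placed elsewhere, but this does not help: as \<open>n \<le> 2k\<close>, any
    two admissible blocks overlap or are adjacent, so if both are empty, then everything between
    the left end of one and the right end of the other is empty, and the two side sums do not
    depend on which of the blocks is used (\<open>side_sums_eq_of_empty_blocks\<close>).

  \<^item> Absorption (\<open>move_into_balanced\<close>): let \<open>L\<^sub>l\<close> be the number of tokens left of the block at \<open>l\<close>, and
    \<open>R\<^sub>l\<close> the number right of it. A window of \<open>z + 1\<close> stacks is a block with one further stack
    next to it, so a move can empty the block at \<open>l\<close> and give one neighbouring stack any height up
    to its present one.
    This balances the sides if \<open>L\<^bsub>l-1\<^esub> \<le> R\<^sub>l \<le> L\<^sub>l\<close> or \<open>R\<^bsub>l+1\<^esub> \<le> L\<^sub>l \<le> R\<^sub>l\<close>. Such an \<open>l\<close> exists by a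
    discrete intermediate value argument: along
    \<open>(L\<^sub>0, R\<^sub>1), (L\<^sub>1, R\<^sub>1), (L\<^sub>1, R\<^sub>2), \<dots>, (L\<^bsub>n-k\<^esub>, R\<^bsub>n-k+1\<^esub>)\<close> one coordinate changes at a time, \<open>L\<close> never
    decreases and \<open>R\<close> never increases, while \<open>L\<^sub>0 = 0\<close> and \<open>R\<^bsub>n-k+1\<^esub> = 0\<close>.
\<close>

section \<open>Kernels of terminating games\<close>

text \<open>Rule induction on the outcomes shows that losing positions lie in the kernel and winning ones
  outside. The converse is an induction on \<open>size_of\<close>, whose decrease
  ensures that each position has an outcome. The set \<open>X\<close> confines the claim to genuine positions:
  a stray object that admits no moves is also lost for the mover.\<close>

lemma mover_loses_iff_mem_kernel:
  fixes size_of :: "'a \<Rightarrow> nat"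
  assumes decreasing: "\<And>p q. mv p q \<Longrightarrow> size_of q < size_of p"
    and closed: "\<And>p q. mv p q \<Longrightarrow> q \<in> X"
    and independent: "\<And>p q. mv p q \<Longrightarrow> p \<in> K \<Longrightarrow> q \<notin> K"
    and absorbing: "\<And>p. p \<in> X \<Longrightarrow> p \<notin> K \<Longrightarrow> \<exists>q\<in>K. mv p q"
    and "p \<in> X"
  shows "mover_loses mv p \<longleftrightarrow> p \<in> K"
proof
  have "mover_wins mv r \<Longrightarrow> r \<notin> K" and "mover_loses mv s \<Longrightarrow> s \<in> X \<longrightarrow> s \<in> K" for r s
  proof (induction rule: mover_wins_mover_loses.inducts)
    case (wins p q)
    then show ?case using independent closed by blast
  next
    case (loses p)
    then show ?case using absorbing by blast
  qed
  then show "mover_loses mv p \<Longrightarrow> p \<in> K" using \<open>p \<in> X\<close> by blast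
next
  have "(p \<in> K \<longrightarrow> mover_loses mv p) \<and> (p \<notin> K \<longrightarrow> mover_wins mv p)"
    using \<open>p \<in> X\<close>
  proof (induction "size_of p" arbitrary: p rule: less_induct)
    case less
    have IH: "(q \<in> K \<longrightarrow> mover_loses mv q) \<and> (q \<notin> K \<longrightarrow> mover_wins mv q)" if "mv p q" for q
      using less.hyps[OF decreasing[OF that] closed[OF that]] .
    show ?case
      using IH independent absorbing[OF less.prems]
      by (meson mover_wins_mover_loses.wins mover_wins_mover_loses.loses)
  qed
  then show "p \<in> K \<Longrightarrow> mover_loses mv p" by blast
qed

section \<open>Moves of PathNim\<close>

text \<open>The requirement that a move removes at least one token takes the form \<open>q \<noteq> p\<close>: a move into
  the kernel from outside satisfies it trivially.\<close>

lemma pn_moveI: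
  assumes "length p = n" and "length q = n" and "i + k \<le> n"
    and outside: "\<And>j. j < n \<Longrightarrow> j < i \<or> i + k \<le> j \<Longrightarrow> q ! j = p ! j"
    and le: "\<And>j. j < n \<Longrightarrow> q ! j \<le> p ! j"
    and "q \<noteq> p"
  shows "pn_move n k p q"
proof -
  obtain j where j: "j < n" "q ! j \<noteq> p ! j"
    using assms nth_equalityI[of q p] by auto
  then have "j \<in> {i..<i + k}" "q ! j < p ! j"
    using outside[OF j(1)] le[OF j(1)] by (simp_all, linarith)
  moreover from this have "p ! j - q ! j \<le> (\<Sum>j\<in>{i..<i + k}. p ! j - q ! j)"
    by (intro member_le_sum) auto
  ultimately show ?thesis
    using assms unfolding pn_move_def positions_def by (auto intro!: exI[of _ i])
qed

lemma pn_moveE: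
  assumes "pn_move n k p q"
  obtains i where "length p = n" "length q = n" "i + k \<le> n"
    "\<And>j. j < n \<Longrightarrow> j < i \<or> i + k \<le> j \<Longrightarrow> q ! j = p ! j"
    "\<And>j. j < n \<Longrightarrow> q ! j \<le> p ! j"
    "(\<Sum>j<n. q ! j) < (\<Sum>j<n. p ! j)"
proof -
  obtain i where i: "length p = n" "length q = n" "i + k \<le> n"
    and outside: "\<forall>j<n. j \<notin> {i..<i + k} \<longrightarrow> q ! j = p ! j"
    and inside: "\<forall>j\<in>{i..<i + k}. q ! j \<le> p ! j"
    and pos: "(\<Sum>j\<in>{i..<i + k}. p ! j - q ! j) \<ge> 1"
    using assms unfolding pn_move_def positions_def by auto
  have le: "q ! j \<le> p ! j" if "j < n" for j
    using outside inside that by (cases "j \<in> {i..<i + k}") auto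
  have "\<exists>j\<in>{i..<i + k}. p ! j - q ! j \<noteq> 0"
    using pos sum.neutral[of "{i..<i + k}" "\<lambda>j. p ! j - q ! j"] by fastforce
  then obtain j where "j \<in> {i..<i + k}" "p ! j - q ! j \<noteq> 0" by blast
  then have "j < n" "q ! j < p ! j" using i(3) by auto
  then have "(\<Sum>j<n. q ! j) < (\<Sum>j<n. p ! j)"
    using le by (intro sum_strict_mono_ex1) auto
  moreover have "q ! j = p ! j" if "j < n" "j < i \<or> i + k \<le> j" for j
    using outside that by auto
  ultimately show ?thesis using that[OF i] le by blast
qed

section \<open>Balanced positions\<close>

definition empty_block :: "nat \<Rightarrow> nat list \<Rightarrow> nat \<Rightarrow> bool" where
  "empty_block z p l \<longleftrightarrow> (\<forall>j\<in>{l..<l + z}. p ! j = 0)"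

definition left_sum :: "nat list \<Rightarrow> nat \<Rightarrow> nat" where
  "left_sum p l = (\<Sum>j<l. p ! j)"

definition right_sum :: "nat list \<Rightarrow> nat \<Rightarrow> nat" where
  "right_sum p r = (\<Sum>j\<in>{r..<length p}. p ! j)"

definition balanced_at :: "nat \<Rightarrow> nat list \<Rightarrow> nat \<Rightarrow> bool" where
  "balanced_at z p l \<longleftrightarrow>
     0 < l \<and> l + z < length p \<and> empty_block z p l \<and> left_sum p l = right_sum p (l + z)"

lemma left_sum_Suc: "left_sum p (Suc l) = left_sum p l + p ! l"
  by (simp add: left_sum_def)

lemma right_sum_Suc: "r < length p \<Longrightarrow> right_sum p r = p ! r + right_sum p (Suc r)"
  by (simp add: right_sum_def sum.atLeast_Suc_lessThan)

lemma sum_eq_left_sum_plus_right_sum: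
  assumes "empty_block z p l" and "l + z \<le> length p"
  shows "(\<Sum>j<length p. p ! j) = left_sum p l + right_sum p (l + z)"
proof -
  have "(\<Sum>j<length p. p ! j) = (\<Sum>j\<in>{0..<l}. p ! j) + (\<Sum>j\<in>{l..<l + z}. p ! j)
      + (\<Sum>j\<in>{l + z..<length p}. p ! j)"
    using assms(2) by (simp add: sum.atLeastLessThan_concat lessThan_atLeast0)
  then show ?thesis
    using assms(1) by (simp add: left_sum_def right_sum_def empty_block_def lessThan_atLeast0)
qed

lemma list_split_iff_balanced:
  "p \<in> {as @ replicate z 0 @ bs | as bs.
      length as + length bs = Suc m \<and> sum_list as = sum_list bs \<and> min (length as) (length bs) \<ge> 1}
   \<longleftrightarrow> length p = Suc m + z \<and> (\<exists>l. balanced_at z p l)" (is "?lhs \<longleftrightarrow> ?rhs")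
proof
  assume ?lhs
  then obtain as bs where p: "p = as @ replicate z 0 @ bs"
    and len: "length as + length bs = Suc m" and bal: "sum_list as = sum_list bs"
    and ne: "length as \<ge> 1" "length bs \<ge> 1"
    by auto
  have "left_sum p (length as) = sum_list as"
    by (simp add: left_sum_def p nth_append sum_list_sum_nth lessThan_atLeast0)
  moreover have "right_sum p (length as + z) = sum_list bs"
  proof -
    have "right_sum p (length as + z) =
        (\<Sum>j\<in>{0 + (length as + z)..<length bs + (length as + z)}. p ! j)"
      by (simp add: right_sum_def p add_ac)
    also have "\<dots> = sum_list bs"
      unfolding sum.shift_bounds_nat_ivl by (simp add: p nth_append sum_list_sum_nth)
    finally show ?thesis .
  qed
  ultimately have "balanced_at z p (length as)"
    using bal ne by (auto simp: balanced_at_def empty_block_def p nth_append)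
  then show ?rhs using len p by auto
next
  assume ?rhs
  then obtain l where len: "length p = Suc m + z" and l: "balanced_at z p l" by blast
  then have bounds: "0 < l" "l + z < length p" by (auto simp: balanced_at_def)
  have "p = take l p @ take z (drop l p) @ drop z (drop l p)"
    by (metis append_take_drop_id)
  moreover have "take z (drop l p) = replicate z 0"
    using l by (intro nth_equalityI) (auto simp: balanced_at_def empty_block_def)
  moreover have "sum_list (take l p) = left_sum p l"
    using bounds by (simp add: left_sum_def sum_list_sum_nth lessThan_atLeast0 min_def)
  moreover have "sum_list (drop z (drop l p)) = right_sum p (l + z)"
  proof -
    have "right_sum p (l + z) = (\<Sum>j\<in>{0 + (l + z)..<(length p - (l + z)) + (l + z)}. p ! j)"
      using bounds by (simp add: right_sum_def)
    also have "\<dots> = sum_list (drop z (drop l p))"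
      unfolding sum.shift_bounds_nat_ivl by (simp add: sum_list_sum_nth add_ac)
    finally show ?thesis ..
  qed
  ultimately show ?lhs
    using l len bounds
    by (intro CollectI exI[of _ "take l p"] exI[of _ "drop z (drop l p)"])
      (auto simp: balanced_at_def)
qed

section \<open>Independence\<close>

text \<open>The hypothesis \<open>l' \<le> l + z\<close> says that the two empty blocks leave no gap, so the
  stacks over which the two left sums (or the two right sums) differ all lie in an empty block.\<close>

lemma side_sums_eq_of_empty_blocks:
  assumes "empty_block z p l" and "empty_block z p l'"
    and "l \<le> l'" and "l' \<le> l + z" and "l' + z \<le> length p"
  shows "left_sum p l' = left_sum p l" and "right_sum p (l' + z) = right_sum p (l + z)"
proof -
  have "(\<Sum>j<l'. p ! j) = (\<Sum>j<l. p ! j)"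
    using assms by (intro sum.mono_neutral_right) (auto simp: empty_block_def)
  then show "left_sum p l' = left_sum p l" by (simp add: left_sum_def)
  have "(\<Sum>j\<in>{l' + z..<length p}. p ! j) = (\<Sum>j\<in>{l + z..<length p}. p ! j)"
    using assms by (intro sum.mono_neutral_left) (auto simp: empty_block_def)
  then show "right_sum p (l' + z) = right_sum p (l + z)" by (simp add: right_sum_def)
qed

lemma no_move_between_balanced:
  assumes mv: "pn_move n (Suc z) p q" and "n \<le> 2 * Suc z" and p: "balanced_at z p l"
  shows "\<not> balanced_at z q l'"
proof
  assume q: "balanced_at z q l'"
  obtain i where len: "length p = n" "length q = n"
    and same: "\<And>j. j < n \<Longrightarrow> j < i \<or> i + Suc z \<le> j \<Longrightarrow> q ! j = p ! j"
    and le: "\<And>j. j < n \<Longrightarrow> q ! j \<le> p ! j"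
    and less: "(\<Sum>j<n. q ! j) < (\<Sum>j<n. p ! j)"
    using mv by (rule pn_moveE) blast
  have l: "0 < l" "l + z < n" "empty_block z p l" "left_sum p l = right_sum p (l + z)"
    using p len by (auto simp: balanced_at_def)
  have l': "0 < l'" "l' + z < n" "empty_block z q l'" "left_sum q l' = right_sum q (l' + z)"
    using q len by (auto simp: balanced_at_def)
  have eq: "empty_block z q l"
    unfolding empty_block_def
  proof
    fix j assume j: "j \<in> {l..<l + z}"
    then have "p ! j = 0" using l(3) by (simp add: empty_block_def)
    with le[of j] j l(2) show "q ! j = 0" by simp
  qed
  have one_side: "left_sum q l = left_sum p l \<or> right_sum q (l + z) = right_sum p (l + z)"
  proof (cases "i < l")
    case True
    then have "right_sum q (l + z) = right_sum p (l + z)"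
      using len same unfolding right_sum_def by (intro sum.cong) auto
    then show ?thesis ..
  next
    case False
    then have "left_sum q l = left_sum p l"
      using l(2) same unfolding left_sum_def by (intro sum.cong) auto
    then show ?thesis ..
  qed
  have "left_sum q l + right_sum q (l + z) < left_sum p l + right_sum p (l + z)"
    using less sum_eq_left_sum_plus_right_sum[OF eq] sum_eq_left_sum_plus_right_sum[OF l(3)] l(2) len
    by simp
  with one_side l(4) have "left_sum q l \<noteq> right_sum q (l + z)" by auto
  moreover have "left_sum q l = right_sum q (l + z)"
  proof (cases "l \<le> l'")
    case True
    then show ?thesis
      using side_sums_eq_of_empty_blocks[OF eq l'(3)] l l' assms(2) len by simp
  next
    case False
    then show ?thesis
      using side_sums_eq_of_empty_blocks[OF l'(3) eq] l l' assms(2) len by simp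
  qed
  ultimately show False ..
qed

section \<open>Absorption\<close>

text \<open>The common form of the two balancing moves, which differ in the side of the block on which the
  stack \<open>c\<close> lies.\<close>

definition clear_block_and_set :: "nat \<Rightarrow> nat list \<Rightarrow> nat \<Rightarrow> nat \<Rightarrow> nat \<Rightarrow> nat list" where
  "clear_block_and_set z p l c x =
     map (\<lambda>j. if j \<in> {l..<l + z} then 0 else if j = c then x else p ! j) [0..<length p]"

lemma move_emptying_block:
  assumes "Suc c = l \<or> c = l + z" and "l + z \<le> length p" and "c < length p"
    and "x \<le> p ! c" and "clear_block_and_set z p l c x \<noteq> p"
  shows "pn_move (length p) (Suc z) p (clear_block_and_set z p l c x)"
proof (rule pn_moveI[where i = "min c l"])
  show "min c l + Suc z \<le> length p" using assms(1-3) by auto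
qed (use assms in \<open>auto simp: clear_block_and_set_def\<close>)

lemma move_into_balanced:
  assumes n: "n = Suc m + z" "0 < m" and len: "length p = n"
    and unbalanced: "\<And>l. \<not> balanced_at z p l"
  shows "\<exists>q. pn_move n (Suc z) p q \<and> (\<exists>l. balanced_at z q l)"
proof -
  let ?crossed = "\<lambda>l. 0 < l \<and> right_sum p (Suc l + z) \<le> left_sum p l"
  define l where "l = (LEAST l. ?crossed l)"
  have last: "?crossed m"
    using n len by (simp add: right_sum_def)
  have l: "0 < l" "right_sum p (Suc l + z) \<le> left_sum p l"
    using LeastI[of ?crossed, OF last] unfolding l_def by auto
  have "l \<le> m"
    unfolding l_def using last by (rule Least_le)
  then have lz: "l + z < n" using n by simp
  obtain l0 where l0: "l = Suc l0" using l(1) gr0_implies_Suc by blast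
  have before: "left_sum p l0 \<le> right_sum p (l + z)"
  proof (cases "l0 = 0")
    case False
    then have "\<not> ?crossed l0"
      using not_less_Least[of l0 ?crossed] l0 unfolding l_def by auto
    then show ?thesis using False l0 by simp
  qed (simp add: left_sum_def)
  show ?thesis
  proof (cases "right_sum p (l + z) \<le> left_sum p l")
    \<comment> \<open>The left side is at least as heavy, and stack \<open>l0\<close> absorbs the surplus.\<close>
    case True
    define x where "x = right_sum p (l + z) - left_sum p l0"
    let ?q = "clear_block_and_set z p l l0 x"
    have x: "x \<le> p ! l0" using True by (simp add: x_def l0 left_sum_Suc)
    have "left_sum ?q l0 = left_sum p l0"
      unfolding left_sum_def using lz len l0 by (intro sum.cong) (auto simp: clear_block_and_set_def)
    moreover have "?q ! l0 = x" using lz len l0 by (simp add: clear_block_and_set_def)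
    moreover have "right_sum ?q (l + z) = right_sum p (l + z)"
      unfolding right_sum_def using lz len l0 by (intro sum.cong) (auto simp: clear_block_and_set_def)
    moreover have "length ?q = n" using len by (simp add: clear_block_and_set_def)
    moreover have "empty_block z ?q l"
      using lz len by (simp add: clear_block_and_set_def empty_block_def)
    ultimately have "balanced_at z ?q l"
      using before lz by (simp add: balanced_at_def l0 left_sum_Suc x_def)
    moreover from this have "pn_move n (Suc z) p ?q"
      using move_emptying_block[of l0 l z p x] unbalanced x lz len l0
      by fastforce
    ultimately show ?thesis by blast
  next
    \<comment> \<open>The right side is heavier, and stack \<open>l + z\<close> absorbs the surplus.\<close>
    case False
    define x where "x = left_sum p l - right_sum p (Suc l + z)"
    let ?q = "clear_block_and_set z p l (l + z) x"
    have x: "x \<le> p ! (l + z)"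
      using False lz len by (simp add: x_def right_sum_Suc)
    have "left_sum ?q l = left_sum p l"
      unfolding left_sum_def using lz len by (intro sum.cong) (auto simp: clear_block_and_set_def)
    moreover have "?q ! (l + z) = x" using lz len by (simp add: clear_block_and_set_def)
    moreover have "right_sum ?q (Suc l + z) = right_sum p (Suc l + z)"
      unfolding right_sum_def using lz len by (intro sum.cong) (auto simp: clear_block_and_set_def)
    moreover have "length ?q = n" using len by (simp add: clear_block_and_set_def)
    moreover have "empty_block z ?q l"
      using lz len by (simp add: clear_block_and_set_def empty_block_def)
    ultimately have "balanced_at z ?q l"
      using l lz by (simp add: balanced_at_def right_sum_Suc x_def)
    moreover from this have "pn_move n (Suc z) p ?q"
      using move_emptying_block[of "l + z" l z p x] unbalanced x lz len
      by fastforce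
    ultimately show ?thesis by blast
  qed
qed

section \<open>The \<open>\<P>\<close>-positions\<close>

lemma P_positions_eq_kernel:
  assumes "K \<subseteq> positions n"
    and "\<And>p q. pn_move n k p q \<Longrightarrow> p \<in> K \<Longrightarrow> q \<notin> K"
    and "\<And>p. length p = n \<Longrightarrow> p \<notin> K \<Longrightarrow> \<exists>q\<in>K. pn_move n k p q"
  shows "P_positions n k = K"
proof -
  have "mover_loses (pn_move n k) p \<longleftrightarrow> p \<in> K" if "p \<in> positions n" for p
  proof (rule mover_loses_iff_mem_kernel[where X = "positions n" and size_of = "\<lambda>p. \<Sum>j<n. p ! j"])
    show "(\<Sum>j<n. q ! j) < (\<Sum>j<n. p ! j)" if "pn_move n k p q" for p q
      using that by (rule pn_moveE)
  qed (use assms that in \<open>auto simp: pn_move_def positions_def\<close>)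
  then show ?thesis using assms(1) unfolding P_positions_def by blast
qed

theorem theorem4p1:
  fixes n k :: nat
  assumes "n \<ge> 1" and "\<lceil>real n / 2\<rceil> \<le> int k" and "k \<le> n"
  shows "(k < n \<longrightarrow>
            P_positions n k =
              {as @ replicate (k - 1) 0 @ bs | as bs.
                 length as + length bs = n - k + 1 \<and>
                 sum_list as = sum_list bs \<and>
                 min (length as) (length bs) \<ge> 1})
       \<and> (k = n \<longrightarrow> P_positions n n = {replicate n 0})"
proof (intro conjI impI)
  assume "k < n"
  have half: "n \<le> 2 * k"
    using assms(2) by (simp add: ceiling_le_iff)
  then obtain z where k: "k = Suc z"
    using assms(1) by (cases k) auto
  define m where "m = n - k"
  have n: "n = Suc m + z" "0 < m" using \<open>k < n\<close> k by (auto simp: m_def)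
  define K where "K = {p. length p = n \<and> (\<exists>l. balanced_at z p l)}"
  have "P_positions n k = K"
  proof (rule P_positions_eq_kernel)
    show "K \<subseteq> positions n" by (auto simp: K_def positions_def)
    show "q \<notin> K" if "pn_move n k p q" "p \<in> K" for p q
      using that no_move_between_balanced half unfolding K_def k by blast
    show "\<exists>q\<in>K. pn_move n k p q" if "length p = n" "p \<notin> K" for p
      using move_into_balanced[OF n that(1)] that
      unfolding K_def k by (auto simp: pn_move_def positions_def)
  qed
  also have "K = {as @ replicate (k - 1) 0 @ bs | as bs.
                 length as + length bs = n - k + 1 \<and>
                 sum_list as = sum_list bs \<and>
                 min (length as) (length bs) \<ge> 1}"
  proof -
    have "k - 1 = z" "n - k + 1 = Suc m" using k by (simp_all add: m_def)
    then show ?thesis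
      unfolding K_def using list_split_iff_balanced[of _ z m] n(1) by (intro set_eqI) simp
  qed
  finally show "P_positions n k = {as @ replicate (k - 1) 0 @ bs | as bs.
                 length as + length bs = n - k + 1 \<and>
                 sum_list as = sum_list bs \<and>
                 min (length as) (length bs) \<ge> 1}" .
next
  show "P_positions n n = {replicate n 0}"
  proof (rule P_positions_eq_kernel)
    show "{replicate n 0} \<subseteq> positions n" by (simp add: positions_def)
    show "q \<notin> {replicate n 0}" if "pn_move n n p q" "p \<in> {replicate n 0}" for p q
      using that by (auto elim: pn_moveE)
    show "\<exists>q\<in>{replicate n 0}. pn_move n n p q" if "length p = n" "p \<notin> {replicate n 0}" for p
      using that by (auto intro!: pn_moveI[where i = 0])
  qed
qed

end
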